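(* Let $D\subseteq [0,\infty)^n$ be a rectangular set, let $\Delta(D):=\{(t,s)\mid t\in D,\ s\in[0,t]\}$, and let $B$ be a Banach space. Assume that the continuous kernel $K\colon\Delta(D)\times B\to B$ fulfills the Lipschitz condition $$\|K(t,s,x)-K(t,s,y)\|\le L(t)\,\|x-y\|$$ for all $(t,s)\in\Delta(D)$ and $x,y\in B$, with a continuous function $L\colon D\to\mathbb{R}_+$. If $f\colon D\to B$ is a continuous function, then the nonlinear Volterra-type equation $$x(t)=f(t)+\int_{[0,t]} K\bigl(t,s,x(s)\bigr)\,ds\qquad(t\in D)$$ has a unique solution $x$ in $\mathscr{C}(D,B)$.
   Context: $\mathbb{R}_+$ denotes the set of positive reals; $n$ is a positive integer. For $a,b\in\mathbb{R}^n$, $a\le b$ means that all coordinates of $b-a$ are nonnegative, and then $[a,b]:=\{u\in\mathbb{R}^n\mid a\le u\le b\}$ is the $n$-dimensional interval (rectangle). A set $D\subseteq[0,\infty)^n$ is rectangular (with respect to the origin) if for all $u\in D$ the rectangle $[0,u]$ is contained in $D$, and the set $[0,\infty)^n\setminus D$ is closed in $\mathbb{R}^n$. Subsets of Euclidean spaces carry the Euclidean subspace topology; $ds$ is integration with respect to $n$-dimensional Lebesgue measure; integrals of $B$-valued functions are Bochner integrals. $\mathscr{C}(D,B)$ is the set of continuous maps from $D$ to $B$. *)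

theory Defs
  imports "HOL-Analysis.Analysis"
begin

text \<open>
  The library's \<^const>\<open>has_bochner_integral\<close> and \<^const>\<open>lebesgue_integral\<close> are restricted to
  second countable, i.e. separable, codomains. The following definitions give the Bochner integral
  for arbitrary Banach spaces, with Borel measurability replaced by strong measurability; the
  integral of a function that is not integrable is 0, as in the library.
\<close>

definition strongly_measurable :: "'a measure \<Rightarrow> ('a \<Rightarrow> 'b::banach) \<Rightarrow> bool" where
  "strongly_measurable M f \<longleftrightarrow>
     (\<exists>s. (\<forall>i. simple_function M (s i)) \<and> (AE x in M. (\<lambda>i::nat. s i x) \<longlonglongrightarrow> f x))"

definition has_strong_bochner_integral ::
    "'a measure \<Rightarrow> ('a \<Rightarrow> 'b::banach) \<Rightarrow> 'b \<Rightarrow> bool" where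
  "has_strong_bochner_integral M f I \<longleftrightarrow>
     strongly_measurable M f \<and>
     (\<exists>s. (\<forall>i. Bochner_Integration.simple_bochner_integrable M (s i)) \<and>
          (\<lambda>i::nat. \<integral>\<^sup>+x. norm (f x - s i x) \<partial>M) \<longlonglongrightarrow> 0 \<and>
          (\<lambda>i. Bochner_Integration.simple_bochner_integral M (s i)) \<longlonglongrightarrow> I)"

definition strong_bochner_integral :: "'a measure \<Rightarrow> ('a \<Rightarrow> 'b::banach) \<Rightarrow> 'b" where
  "strong_bochner_integral M f =
     (if \<exists>I. has_strong_bochner_integral M f I
      then THE I. has_strong_bochner_integral M f I else 0)"

text \<open>For separable codomains and complete measures these are the library notions.\<close>

lemma strongly_measurable_iff_borel_measurable:
  fixes f :: "'a \<Rightarrow> 'b::{banach, second_countable_topology}"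
  assumes "complete_measure M"
  shows "strongly_measurable M f \<longleftrightarrow> f \<in> borel_measurable M"
proof
  interpret complete_measure M by fact
  assume "strongly_measurable M f"
  then obtain s where s: "\<And>i::nat. simple_function M (s i)"
    and lim: "AE x in M. (\<lambda>i. s i x) \<longlonglongrightarrow> f x"
    unfolding strongly_measurable_def by blast
  define N where "N = {x \<in> space M. \<not> (\<lambda>i. s i x) \<longlonglongrightarrow> f x}"
  have N: "N \<in> null_sets M"
    using lim unfolding AE_iff_null_sets N_def .
  then have N_sets: "N \<in> sets M" by auto
  define g where "g = (\<lambda>x. if x \<in> N then 0 else f x)"
  have "g \<in> borel_measurable M"
  proof (rule borel_measurable_LIMSEQ_metric)
    show "(\<lambda>x. if x \<in> N then 0 else s i x) \<in> borel_measurable M" for i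
      using borel_measurable_simple_function[OF s[of i]] N_sets by measurable
    show "(\<lambda>i. if x \<in> N then 0 else s i x) \<longlonglongrightarrow> g x" if "x \<in> space M" for x
      using that by (auto simp: g_def N_def)
  qed
  show "f \<in> borel_measurable M"
  proof (rule measurableI)
    fix A :: "'b set" assume "A \<in> sets borel"
    then have "g -` A \<inter> space M \<in> sets M"
      using \<open>g \<in> borel_measurable M\<close> by (rule measurable_sets[rotated])
    moreover have "f -` A \<inter> N \<in> sets M"
      using complete[of "f -` A \<inter> N" N] N by auto
    moreover have "f -` A \<inter> space M = (g -` A \<inter> space M - N) \<union> (f -` A \<inter> N)"
      by (auto simp: g_def N_def split: if_splits)
    ultimately show "f -` A \<inter> space M \<in> sets M"
      using N_sets by auto
  qed auto
next
  assume "f \<in> borel_measurable M"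
  from borel_measurable_implies_sequence_metric[OF this, of 0]
  obtain s where "\<And>i. simple_function M (s i)"
    "\<And>x. x \<in> space M \<Longrightarrow> (\<lambda>i. s i x) \<longlonglongrightarrow> f x"
    by blast
  then show "strongly_measurable M f"
    unfolding strongly_measurable_def by blast
qed

lemma has_strong_bochner_integral_iff:
  fixes f :: "'a \<Rightarrow> 'b::{banach, second_countable_topology}"
  assumes "complete_measure M"
  shows "has_strong_bochner_integral M f = has_bochner_integral M f"
  unfolding has_strong_bochner_integral_def has_bochner_integral.simps fun_eq_iff
    strongly_measurable_iff_borel_measurable[OF assms]
  by blast

lemma strong_bochner_integral_eq_lebesgue_integral:
  fixes f :: "'a \<Rightarrow> 'b::{banach, second_countable_topology}"
  assumes "complete_measure M"
  shows "strong_bochner_integral M f = integral\<^sup>L M f"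
  unfolding strong_bochner_integral_def lebesgue_integral_def
    has_strong_bochner_integral_iff[OF assms] ..

definition rectangular :: "(real ^ 'n) set \<Rightarrow> bool" where
  "rectangular D \<longleftrightarrow> D \<subseteq> {0..} \<and> (\<forall>u\<in>D. {0..u} \<subseteq> D) \<and> closed ({0..} - D)"

definition Delta :: "(real ^ 'n) set \<Rightarrow> ((real ^ 'n) \<times> (real ^ 'n)) set" where
  "Delta D = {(t, s). t \<in> D \<and> s \<in> {0..t}}"

text \<open>
  Functions on \<open>D\<close> are represented by their extension with \<^const>\<open>undefined\<close> outside \<open>D\<close>,
  so that equality of elements is equality on \<open>D\<close>.
\<close>

definition continuous_maps :: "'a::topological_space set \<Rightarrow> ('a \<Rightarrow> 'b::topological_space) set" where
  "continuous_maps D = {x \<in> extensional D. continuous_on D x}"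

end

theory Submission
  imports Defs
begin

text \<open>
  On a box \<open>[0, T]\<close> with \<open>T \<in> D\<close> the Lipschitz constants \<open>L(t)\<close> are bounded by some \<open>M\<close>. With respect to
  the weighted supremum norm for the weight \<open>w(t) = exp (c * (t\<^sub>1 + \<dots> + t\<^sub>n))\<close>, the Volterra operator
  is a contraction with factor \<open>M / c^n\<close>, because the integral of \<open>w\<close> over \<open>[0, t]\<close> is at most
  \<open>w(t) / c^n\<close>. So there is a unique solution on every such box. The solutions agree on common
  subboxes and glue to a function on \<open>D\<close>; it is continuous since every point of a rectangular set
  has a relative neighbourhood of the form \<open>[0, T]\<close> with \<open>T \<in> D\<close>. All integrands are continuous, and
  for those the strong Bochner integral is the Henstock--Kurzweil integral.
\<close>

section \<open>Strong Bochner integrals of continuous functions on boxes\<close>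

text \<open>Both integrals reduce to the same finite sum over the level sets \<open>A y\<close>:
  these are Lebesgue measurable subsets of \<open>S\<close> of finite measure, and the
  Henstock--Kurzweil integral of their indicators is their measure. This is the first link between
  the two notions of integral.\<close>

lemma simple_bochner_integral_has_integral:
  fixes s :: "'a::euclidean_space \<Rightarrow> 'b::banach"
  assumes s: "Bochner_Integration.simple_bochner_integrable (lebesgue_on S) s" and S: "S \<in> lmeasurable"
  shows "(s has_integral Bochner_Integration.simple_bochner_integral (lebesgue_on S) s) S"
proof -
  have S': "S \<in> sets lebesgue" using S by (rule fmeasurableD)
  have sf: "simple_function (lebesgue_on S) s"
    using s by (auto elim: simple_bochner_integrable.cases)
  then have fin: "finite (s ` S)" 
    by (auto dest: simple_functionD(1))
  define A where "A y = {x \<in> S. s x = y}" for y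
  have "A y \<in> lmeasurable" for y
  proof -
    have "s -` {y} \<inter> space (lebesgue_on S) \<in> sets (lebesgue_on S)"
      using simple_functionD(2)[OF sf] .
    also have "s -` {y} \<inter> space (lebesgue_on S) = A y" by (auto simp: A_def)
    finally have "A y \<in> sets lebesgue" using S' by (simp add: sets_restrict_space_iff)
    then show ?thesis by (rule fmeasurableI2[OF S, rotated]) (auto simp: A_def)
  qed
  then have "((\<lambda>x. \<Sum>y\<in>s ` S. indicator (A y) x *\<^sub>R y) has_integral
      (\<Sum>y\<in>s ` S. measure lebesgue (A y) *\<^sub>R y)) UNIV"
    by (intro has_integral_sum fin has_integral_scaleR_left) (auto simp: lmeasurable_iff_has_integral)
  moreover have "(\<Sum>y\<in>s ` S. indicator (A y) x *\<^sub>R y) = (if x \<in> S then s x else 0)" for x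
  proof (cases "x \<in> S")
    case True
    then have "(\<Sum>y\<in>s ` S. indicator (A y) x *\<^sub>R y) = (\<Sum>y\<in>s ` S. if y = s x then y else 0)"
      by (intro sum.cong) (auto simp: A_def)
    then show ?thesis using True fin by simp
  qed (auto simp: A_def)
  moreover have "Bochner_Integration.simple_bochner_integral (lebesgue_on S) s = 
      (\<Sum>y\<in>s ` S. measure lebesgue (A y) *\<^sub>R y)"
    unfolding simple_bochner_integral_def 
    by (auto intro!: sum.cong simp: A_def measure_restrict_space S')
  ultimately show ?thesis
    by (simp add: has_integral_restrict_UNIV)
qed

text \<open>
  Controls the simple approximations of \<open>g\<close> without Bochner integrals: the Henstock--Kurzweil
  integral, unlike the library's Bochner integral, is available in non-separable Banach spaces.
\<close>

lemma norm_integral_diff_simple_le: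
  fixes g s :: "'a::euclidean_space \<Rightarrow> 'b::banach"
  assumes s: "Bochner_Integration.simple_bochner_integrable (lebesgue_on (cbox a b)) s"
    and g: "continuous_on (cbox a b) g"
  shows "ennreal (norm (integral (cbox a b) g - Bochner_Integration.simple_bochner_integral (lebesgue_on (cbox a b)) s))
    \<le> (\<integral>\<^sup>+x. norm (g x - s x) \<partial>lebesgue_on (cbox a b))"
proof (cases "(\<integral>\<^sup>+x. norm (g x - s x) \<partial>lebesgue_on (cbox a b)) < \<infinity>")
  \<comment> \<open>If the right-hand side is infinite, the bound is trivial. Finiteness makes
    \<open>?h\<close> integrable once it is known to be measurable.\<close>
  case True
  let ?M = "lebesgue_on (cbox a b)" and ?h = "\<lambda>x. norm (g x - s x)"
  have sf: "simple_function ?M s"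
    using s by (auto elim: simple_bochner_integrable.cases)
  then have fin: "finite (s ` cbox a b)" 
    by (auto dest: simple_functionD(1))
  have s_meas: "{x \<in> space ?M. s x = y} \<in> sets ?M" for y
    using simple_functionD(2)[OF sf, of "{y}"] by (simp add: vimage_def Int_def conj_commute)
  \<comment> \<open>Only the real function \<open>?h\<close> has to be measurable, so measurability
    of \<open>g - s\<close> in the possibly non-separable space is avoided: on the level set of a
    value \<open>y\<close> of \<open>s\<close>, \<open>?h\<close> equals the continuous function
    \<open>norm (g x - y)\<close>, and there are finitely many such values.\<close>
  have "(\<lambda>x. \<Sum>y\<in>s ` cbox a b. indicator {x \<in> space ?M. s x = y} x * norm (g x - y)) \<in> borel_measurable ?M"
    using s_meas
    by (intro borel_measurable_sum borel_measurable_times borel_measurable_indicator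
        continuous_imp_measurable_on_sets_lebesgue continuous_intros g) auto
  also have "?this \<longleftrightarrow> ?h \<in> borel_measurable ?M"
  proof (rule measurable_cong)
    fix x assume "x \<in> space ?M"
    then have "(\<Sum>y\<in>s ` cbox a b. indicator {x \<in> space ?M. s x = y} x * norm (g x - y)) = 
      (\<Sum>y\<in>s ` cbox a b. if y = s x then norm (g x - y) else 0)"
      by (intro sum.cong) auto
    then show "(\<Sum>y\<in>s ` cbox a b. indicator {x \<in> space ?M. s x = y} x * norm (g x - y)) = ?h x"
      using fin \<open>x \<in> space ?M\<close> by simp
  qed
  finally have int: "integrable ?M ?h"
    using True by (intro integrableI_bounded) auto
  note si = simple_bochner_integral_has_integral[OF s lmeasurable_cbox]
  have gi: "g integrable_on cbox a b" using g by (rule integrable_continuous)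
  have "norm (integral (cbox a b) g - Bochner_Integration.simple_bochner_integral ?M s) =
     norm (integral (cbox a b) (\<lambda>x. g x - s x))"
    using si gi by (subst integral_diff) (auto simp: has_integral_iff)
  also have "\<dots> \<le> integral (cbox a b) ?h"
    using si gi int by (intro integral_norm_bound_integral integrable_diff integrable_on_lebesgue_on) auto
  also have "\<dots> = integral\<^sup>L ?M ?h"
    using int by (intro integral_unique has_integral_integral_lebesgue_on) auto
  also have "ennreal \<dots> = (\<integral>\<^sup>+x. ?h x \<partial>?M)"
    using int by (intro nn_integral_eq_integral[symmetric]) auto
  finally show ?thesis by (simp add: ennreal_leI)
qed (auto simp: top_unique not_less)

text \<open>The image of the box is compact, hence covered by finitely many balls of radius
  \<open>e\<close>. This total boundedness takes the place of separability of the codomain.\<close>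

lemma simple_function_approximation_continuous:
  fixes g :: "'a::euclidean_space \<Rightarrow> 'b::banach"
  assumes g: "continuous_on (cbox a b) g" and e: "0 < e"
  obtains s where "Bochner_Integration.simple_bochner_integrable (lebesgue_on (cbox a b)) s"
    "\<And>x. x \<in> cbox a b \<Longrightarrow> norm (g x - s x) < e"
proof -
  let ?M = "lebesgue_on (cbox a b)"
  have "compact (g ` cbox a b)" using g by (intro compact_continuous_image) auto
  then obtain k where k: "finite k" "g ` cbox a b \<subseteq> (\<Union>y\<in>k. ball y e)"
    using e unfolding compact_eq_totally_bounded by blast
  obtain y :: "nat \<Rightarrow> 'b" and n where y: "k = y ` {i. i < n}"
    using finite_imp_nat_seg_image_inj_on[OF k(1)] by blast
  \<comment> \<open>Taking the least index of a ball containing \<open>g x\<close> makes the choice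
    of a centre measurable, since it depends only on countably many measurable predicates.\<close>
  define j where "j x = (LEAST i. i < n \<and> dist (g x) (y i) < e)" for x
  have j: "j x < n" "dist (g x) (y (j x)) < e" if x: "x \<in> cbox a b" for x
  proof -
    have "\<exists>i. i < n \<and> dist (g x) (y i) < e" using k(2) x by (force simp: y dist_commute)
    from LeastI_ex[OF this] show "j x < n" "dist (g x) (y (j x)) < e" by (auto simp: j_def)
  qed
  have "Measurable.pred ?M (\<lambda>x. i < n \<and> dist (g x) (y i) < e)" for i
  proof -
    have "(\<lambda>x. dist (g x) (y i)) \<in> borel_measurable ?M"
      by (intro continuous_imp_measurable_on_sets_lebesgue continuous_intros g) auto
    then show ?thesis by measurable
  qed
  then have jm: "j \<in> measurable ?M (count_space UNIV)"
    unfolding j_def by measurable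
  have "simple_function ?M j"
    unfolding simple_function_def
  proof
    have "j ` space ?M \<subseteq> {..<n}" using j(1) by auto
    then show "finite (j ` space ?M)" by (rule finite_subset) auto
    show "\<forall>i\<in>j ` space ?M. j -` {i} \<inter> space ?M \<in> sets ?M"
      using measurable_sets[OF jm] by auto
  qed
  then have "simple_function ?M (\<lambda>x. y (j x))" by (rule simple_function_compose1)
  moreover have "emeasure ?M {x \<in> space ?M. y (j x) \<noteq> 0} \<noteq> \<infinity>"
  proof -
    have "emeasure ?M {x \<in> space ?M. y (j x) \<noteq> 0} \<le> emeasure ?M (space ?M)"
      by (intro emeasure_space)
    also have "\<dots> < \<infinity>"
      by (simp add: emeasure_restrict_space emeasure_lborel_cbox_eq)
    finally show ?thesis by auto
  qed
  ultimately have "Bochner_Integration.simple_bochner_integrable ?M (\<lambda>x. y (j x))"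
    by (rule simple_bochner_integrable.intros)
  then show ?thesis using j(2) by (intro that) (auto simp: dist_norm)
qed

lemma has_strong_bochner_integral_continuous_iff:
  fixes g :: "'a::euclidean_space \<Rightarrow> 'b::banach"
  assumes g: "continuous_on (cbox a b) g"
  shows "has_strong_bochner_integral (lebesgue_on (cbox a b)) g I \<longleftrightarrow> I = integral (cbox a b) g"
proof -
  let ?M = "lebesgue_on (cbox a b)" and ?J = "integral (cbox a b) g"
  have lim: "(\<lambda>i. Bochner_Integration.simple_bochner_integral ?M (s i)) \<longlonglongrightarrow> ?J"
    if s: "\<And>i. Bochner_Integration.simple_bochner_integrable ?M (s i)"
      and "(\<lambda>i::nat. \<integral>\<^sup>+x. norm (g x - s i x) \<partial>?M) \<longlonglongrightarrow> 0" for s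
  proof -
    have "(\<lambda>i. ennreal (norm (?J - Bochner_Integration.simple_bochner_integral ?M (s i)))) \<longlonglongrightarrow> ennreal 0"
      by (rule tendsto_sandwich[OF _ _ tendsto_const])
        (use that norm_integral_diff_simple_le[OF s g] in auto)
    then have "(\<lambda>i. norm (?J - Bochner_Integration.simple_bochner_integral ?M (s i))) \<longlonglongrightarrow> 0"
      by (subst (asm) tendsto_ennreal_iff) auto
    then have "(\<lambda>i. ?J - (?J - Bochner_Integration.simple_bochner_integral ?M (s i))) \<longlonglongrightarrow> ?J - 0"
      by (intro tendsto_diff tendsto_const) (simp add: tendsto_norm_zero_iff)
    then show ?thesis by simp
  qed
  have "\<exists>s. Bochner_Integration.simple_bochner_integrable ?M s \<and>
      (\<forall>x\<in>cbox a b. norm (g x - s x) < inverse (real (Suc i)))" for i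
    by (rule simple_function_approximation_continuous[OF g, of "inverse (real (Suc i))"]) auto
  then obtain s where s: "\<And>i. Bochner_Integration.simple_bochner_integrable ?M (s i)"
    and s_le: "\<And>i x. x \<in> cbox a b \<Longrightarrow> norm (g x - s i x) < inverse (real (Suc i))"
    by metis
  have "(\<lambda>i. s i x) \<longlonglongrightarrow> g x" if "x \<in> cbox a b" for x
  proof -
    have "(\<lambda>i. norm (g x - s i x)) \<longlonglongrightarrow> 0"
      by (rule tendsto_sandwich[OF _ _ tendsto_const LIMSEQ_inverse_real_of_nat])
        (intro always_eventually allI norm_ge_zero less_imp_le[OF s_le[OF that]])+
    then have "(\<lambda>i. g x - (g x - s i x)) \<longlonglongrightarrow> g x - 0"
      by (intro tendsto_diff tendsto_const) (simp add: tendsto_norm_zero_iff)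
    then show ?thesis by simp
  qed
  then have meas: "strongly_measurable ?M g"
    unfolding strongly_measurable_def using s
    by (intro exI[of _ s]) (auto elim: simple_bochner_integrable.cases)
  have nn: "(\<lambda>i. \<integral>\<^sup>+x. norm (g x - s i x) \<partial>?M) \<longlonglongrightarrow> 0"
  proof (rule tendsto_sandwich[OF _ _ tendsto_const])
    show "\<forall>\<^sub>F i in sequentially. (\<integral>\<^sup>+x. norm (g x - s i x) \<partial>?M) \<le> 
        ennreal (inverse (real (Suc i)) * measure lborel (cbox a b))"
    proof (rule always_eventually, rule allI)
      fix i
      have "(\<integral>\<^sup>+x. norm (g x - s i x) \<partial>?M) \<le> (\<integral>\<^sup>+x. ennreal (inverse (real (Suc i))) \<partial>?M)"
        using s_le[of _ i] by (intro nn_integral_mono ennreal_leI) (auto intro: less_imp_le)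
      also have "\<dots> = ennreal (inverse (real (Suc i))) * emeasure lborel (cbox a b)"
        by (simp add: emeasure_restrict_space)
      also have "emeasure lborel (cbox a b) = ennreal (measure lborel (cbox a b))"
        by (intro emeasure_eq_ennreal_measure) (simp add: emeasure_lborel_cbox_eq)
      finally show "(\<integral>\<^sup>+x. norm (g x - s i x) \<partial>?M) \<le> 
        ennreal (inverse (real (Suc i)) * measure lborel (cbox a b))"
        by (simp add: ennreal_mult)
    qed
    have "(\<lambda>i. inverse (real (Suc i)) * measure lborel (cbox a b)) \<longlonglongrightarrow> 0"
      using tendsto_mult_left_zero[OF LIMSEQ_inverse_real_of_nat] .
    from tendsto_ennrealI[OF this]
    show "(\<lambda>i. ennreal (inverse (real (Suc i)) * measure lborel (cbox a b))) \<longlonglongrightarrow> 0" by simp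
  qed auto
  have "has_strong_bochner_integral ?M g ?J"
    unfolding has_strong_bochner_integral_def using meas s nn lim[OF s nn] by blast
  moreover have "I = ?J" if "has_strong_bochner_integral ?M g I"
    using that lim LIMSEQ_unique unfolding has_strong_bochner_integral_def by blast
  ultimately show ?thesis by blast
qed

lemma strong_bochner_integral_continuous:
  fixes g :: "'a::euclidean_space \<Rightarrow> 'b::banach"
  assumes g: "continuous_on (cbox a b) g"
  shows "strong_bochner_integral (lebesgue_on (cbox a b)) g = integral (cbox a b) g"
proof -
  have "has_strong_bochner_integral (lebesgue_on (cbox a b)) g = (\<lambda>I. I = integral (cbox a b) g)"
    by (intro ext has_strong_bochner_integral_continuous_iff[OF g])
  then show ?thesis by (simp add: strong_bochner_integral_def)
qed

section \<open>Integrals over boxes with lower corner at the origin\<close>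

text \<open>
  Moves the dependence on the upper limit from the domain into the integrand, which makes
  continuity in \<open>t\<close> a matter of continuous parameters; the product \<open>t * u\<close> is componentwise.
\<close>

lemma integral_cbox_stretch:
  fixes g :: "real ^ 'n \<Rightarrow> 'b::banach"
  assumes t: "0 \<le> t" and g: "continuous_on (cbox 0 t) g"
  shows "integral (cbox 0 t) g = (\<Prod>i\<in>UNIV. t $ i) *\<^sub>R integral (cbox 0 1) (\<lambda>u. g (t * u))"
proof (cases "\<exists>i. t $ i = 0")
  \<comment> \<open>A vanishing coordinate of \<open>t\<close> makes the box a null set and the
    product zero, so both sides vanish. Otherwise the stretch by \<open>t\<close> is
    invertible.\<close>
  case True
  then obtain i where i: "t $ i = 0" by blast
  then have "measure lborel (cbox 0 t) = 0"
    using t by (subst content_cbox_cart) (auto simp: interval_cbox_cart[symmetric] intro!: prod_zero)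
  moreover have "(\<Prod>i\<in>UNIV. t $ i) = 0" using i by (auto intro!: prod_zero)
  ultimately show ?thesis by (simp add: integral_null)
next
  case False
  then have pos: "0 < t $ i" for i
    using t False by (metis less_eq_vec_def order_le_less zero_index)
  have im: "(\<lambda>x. \<chi> k. x $ k / t $ k) ` cbox 0 t = cbox 0 1"
  proof (intro equalityI subsetI)
    fix u :: "real ^ 'n" assume u: "u \<in> cbox 0 1"
    have "u = (\<chi> k. (t * u) $ k / t $ k)" using False by (auto simp: vec_eq_iff)
    moreover have "t * u \<in> cbox 0 t" using u t
      by (auto simp: mem_box_cart less_eq_vec_def intro: mult_left_le)
    ultimately show "u \<in> (\<lambda>x. \<chi> k. x $ k / t $ k) ` cbox 0 t" by (rule image_eqI)
  qed (auto simp: mem_box_cart pos less_imp_le[OF pos] intro!: divide_nonneg_nonneg)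
  have "(g has_integral integral (cbox 0 t) g) (cbox 0 t)"
    using g by (intro integrable_integral integrable_continuous)
  from has_integral_stretch_cart[OF this, of "\<lambda>i. t $ i"] False
  have "((\<lambda>u. g (t * u)) has_integral (integral (cbox 0 t) g /\<^sub>R \<bar>\<Prod>i\<in>UNIV. t $ i\<bar>)) (cbox 0 1)"
    by (simp add: im times_vec_def)
  then have "integral (cbox 0 1) (\<lambda>u. g (t * u)) = integral (cbox 0 t) g /\<^sub>R \<bar>\<Prod>i\<in>UNIV. t $ i\<bar>"
    by (rule integral_unique)
  then show ?thesis using pos by (simp add: prod_nonneg less_imp_le abs_of_nonneg False)
qed

text \<open>The weight is a product of functions of one coordinate each, so the integral over the
  box factors into one-dimensional integrals of exponentials.\<close>

lemma integral_exp_sum_le: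
  fixes t :: "real ^ 'n"
  assumes c: "0 < c" and t: "0 \<le> t"
  shows "integral (cbox 0 t) (\<lambda>s. exp (c * (\<Sum>i\<in>UNIV. s $ i))) \<le> exp (c * (\<Sum>i\<in>UNIV. t $ i)) / c ^ CARD('n)"
proof -
  let ?g = "\<lambda>s::real^'n. exp (c * (\<Sum>i\<in>UNIV. s $ i))"
  have UB: "(\<Sum>i\<in>UNIV. s $ i) = (\<Sum>b\<in>Basis. s \<bullet> b)" for s :: "real ^ 'n"
    by (simp add: Basis_vec_def sum.UNION_disjoint cart_eq_inner_axis sum.reindex inj_on_def axis_eq_axis
        image_def[symmetric] UNION_singleton_eq_range)
  \<comment> \<open>Each factor carries the indicator of its own interval, so that the product over
    \<open>Basis\<close> absorbs the indicator of the box and \<open>nn_integral_lborel_prod\<close>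
    applies. \<open>UB\<close> rewrites the coordinate sum over \<open>Basis\<close> for the same
    purpose.\<close>
  define F where "F b r = ennreal (exp (c * r)) * indicator {0..t \<bullet> b} r" for b r
  have tb: "0 \<le> t \<bullet> b" if "b \<in> Basis" for b
    using t that by (auto simp: Basis_vec_def less_eq_vec_def inner_axis)
  have "(?g has_integral integral (cbox 0 t) ?g) (cbox 0 t)"
    by (intro integrable_integral integrable_continuous continuous_intros)
  then have "ennreal (integral (cbox 0 t) ?g) = (\<integral>\<^sup>+s. ennreal (?g s) * indicator (cbox 0 t) s \<partial>lborel)"
    by (intro nn_integral_has_integral_lebesgue'[symmetric]) auto
  also have "\<dots> = (\<integral>\<^sup>+s. (\<Prod>b\<in>Basis. F b (s \<bullet> b)) \<partial>lborel)"
  proof (rule nn_integral_cong)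
    fix s :: "real ^ 'n"
    have "indicator (cbox 0 t) s = (\<Prod>b\<in>Basis. indicator {0..t \<bullet> b} (s \<bullet> b) :: ennreal)"
      by (auto simp: indicator_def mem_box prod_zero_iff)
    then show "ennreal (?g s) * indicator (cbox 0 t) s = (\<Prod>b\<in>Basis. F b (s \<bullet> b))"
      by (simp add: F_def prod.distrib UB sum_distrib_left exp_sum prod_ennreal)
  qed
  also have "\<dots> = (\<Prod>b\<in>Basis. (\<integral>\<^sup>+r. F b r \<partial>lborel))"
    by (rule nn_integral_lborel_prod) (auto simp: F_def)
  also have "\<dots> \<le> (\<Prod>b\<in>(Basis::(real^'n) set). ennreal (exp (c * (t \<bullet> b)) / c))"
  proof (rule prod_mono_ennreal)
    fix b :: "real ^ 'n" assume b: "b \<in> Basis"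
    have "(\<integral>\<^sup>+r. F b r \<partial>lborel) = ennreal (exp (c * (t \<bullet> b)) / c - exp (c * 0) / c)"
      unfolding F_def using c tb[OF b]
      by (intro nn_integral_FTC_Icc[where F="\<lambda>r. exp (c * r) / c"])
        (auto intro!: derivative_eq_intros)
    \<comment> \<open>The contribution \<open>1 / c\<close> of the lower endpoint is discarded,
      which leaves a multiple of the weight at \<open>t\<close> itself.\<close>
    also have "\<dots> \<le> ennreal (exp (c * (t \<bullet> b)) / c)" using c by (intro ennreal_leI) auto
    finally show "(\<integral>\<^sup>+r. F b r \<partial>lborel) \<le> ennreal (exp (c * (t \<bullet> b)) / c)" .
  qed
  also have "\<dots> = ennreal (?g t / c ^ CARD('n))"
    using c by (subst prod_ennreal) (auto simp: prod_dividef UB sum_distrib_left exp_sum)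
  finally show ?thesis using c by (subst (asm) ennreal_le_iff) auto
qed

section \<open>Fixed points in a weighted supremum norm\<close>

text \<open>This is Banach's fixed point theorem for the norm \<open>sup |x t| / w t\<close>. The
  hypothesis \<open>contraction\<close> uses pointwise bounds by multiples of \<open>w\<close>, so
  that it can be checked without forming a space of functions on the box.\<close>

lemma weighted_contraction_unique_fixpoint:
  fixes V :: "('a::euclidean_space \<Rightarrow> 'b::banach) \<Rightarrow> 'a \<Rightarrow> 'b"
  assumes cont: "\<And>x. continuous_on (cbox a b) x \<Longrightarrow> continuous_on (cbox a b) (V x)"
    and w: "continuous_on (cbox a b) w" and w_pos: "\<And>t. t \<in> cbox a b \<Longrightarrow> 0 < w t"
    and q: "0 \<le> q" "q < 1"
    and contraction: "\<And>x y c t. continuous_on (cbox a b) x \<Longrightarrow> continuous_on (cbox a b) y \<Longrightarrow>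
      0 \<le> c \<Longrightarrow> (\<And>s. s \<in> cbox a b \<Longrightarrow> norm (x s - y s) \<le> c * w s) \<Longrightarrow> t \<in> cbox a b \<Longrightarrow>
      norm (V x t - V y t) \<le> q * c * w t"
  shows weighted_contraction_fixpoint:
      "\<exists>x. continuous_on (cbox a b) x \<and> (\<forall>t\<in>cbox a b. V x t = x t)"
    and weighted_contraction_fixpoint_unique:
      "\<And>x y t. continuous_on (cbox a b) x \<Longrightarrow> \<forall>t\<in>cbox a b. V x t = x t \<Longrightarrow>
         continuous_on (cbox a b) y \<Longrightarrow> \<forall>t\<in>cbox a b. V y t = y t \<Longrightarrow> t \<in> cbox a b \<Longrightarrow> x t = y t"
proof -
  show uniq: "x t = y t"
    if x: "continuous_on (cbox a b) x" "\<forall>t\<in>cbox a b. V x t = x t"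
      and y: "continuous_on (cbox a b) y" "\<forall>t\<in>cbox a b. V y t = y t" and t: "t \<in> cbox a b" for x y t
  proof -
    have w0: "w t \<noteq> 0" if "t \<in> cbox a b" for t using w_pos[OF that] by simp
    have "continuous_on (cbox a b) (\<lambda>t. norm (x t - y t) / w t)"
      using w0 by (intro continuous_intros x y w) auto
    then obtain u where u: "u \<in> cbox a b"
      and sup: "\<And>s. s \<in> cbox a b \<Longrightarrow> norm (x s - y s) / w s \<le> norm (x u - y u) / w u"
      using continuous_attains_sup[OF compact_cbox, of a b] t by blast
    \<comment> \<open>The weighted distance of \<open>x\<close> and \<open>y\<close>, attained at
      \<open>u\<close> by compactness. Applying \<open>contraction\<close> with this bound at
      \<open>u\<close> yields \<open>c \<le> q * c\<close>, hence \<open>c = 0\<close>.\<close>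
    define c where "c = norm (x u - y u) / w u"
    have le: "norm (x s - y s) \<le> c * w s" if "s \<in> cbox a b" for s
      using sup[OF that] w_pos[OF that] by (simp add: c_def pos_divide_le_eq)
    have c0: "0 \<le> c" using w_pos[OF u] by (simp add: c_def)
    have "norm (x u - y u) \<le> q * c * w u"
      using contraction[OF x(1) y(1) c0 le u] x(2) y(2) u by simp
    then have "c \<le> q * c" using w_pos[OF u] by (simp add: c_def pos_divide_le_eq)
    then have "(1 - q) * c \<le> 0" by (simp add: algebra_simps)
    then have "c \<le> 0" using q by (simp add: mult_le_0_iff)
    then show ?thesis using le[OF t] c0 by simp
  qed
  show "\<exists>x. continuous_on (cbox a b) x \<and> (\<forall>t\<in>cbox a b. V x t = x t)"
  proof (cases "cbox a b = {}")
    case False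
    have w0: "w t \<noteq> 0" if "t \<in> cbox a b" for t using w_pos[OF that] by simp
    have cw: "continuous_on (cbox a b) (\<lambda>t. w t *\<^sub>R apply_bcontfun y t)" for y :: "'a \<Rightarrow>\<^sub>C 'b"
      by (intro continuous_on_scaleR w) simp
    \<comment> \<open>Conjugating \<open>V\<close> with multiplication by \<open>w\<close> turns the
      weighted norm into the ordinary supremum norm. Composing with \<open>clamp\<close> extends the
      result from the box to a bounded continuous function on the whole space, so Banach's theorem
      applies to the complete type of such functions.\<close>
    have "\<exists>z::'a \<Rightarrow>\<^sub>C 'b. \<forall>t. z t = inverse (w (clamp a b t)) *\<^sub>R V (\<lambda>t. w t *\<^sub>R y t) (clamp a b t)" 
      for y :: "'a \<Rightarrow>\<^sub>C 'b"
    proof -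
      have "continuous_on (cbox a b) (\<lambda>t. inverse (w t) *\<^sub>R V (\<lambda>t. w t *\<^sub>R y t) t)"
        using w0 by (intro continuous_intros w cont) auto
      then show ?thesis by (rule continuous_on_cbox_bcontfunE) blast
    qed
    then obtain T :: "('a \<Rightarrow>\<^sub>C 'b) \<Rightarrow> ('a \<Rightarrow>\<^sub>C 'b)" where
      T: "\<And>y t. T y t = inverse (w (clamp a b t)) *\<^sub>R V (\<lambda>t. w t *\<^sub>R y t) (clamp a b t)" by metis
    have "dist (T y) (T z) \<le> q * dist y z" for y z
    proof (rule dist_bound)
      fix t
      define u where "u = clamp a b t"
      have u: "u \<in> cbox a b" unfolding u_def using False by (intro clamp_in_interval) (auto simp: box_ne_empty)
      have "norm (V (\<lambda>t. w t *\<^sub>R y t) u - V (\<lambda>t. w t *\<^sub>R z t) u) \<le> q * dist y z * w u"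
      proof (rule contraction[OF cw cw _ _ u])
        fix s assume s: "s \<in> cbox a b"
        have "norm (w s *\<^sub>R y s - w s *\<^sub>R z s) = w s * dist (y s) (z s)"
          using w_pos[OF s] by (simp add: dist_norm flip: scaleR_diff_right)
        also have "\<dots> \<le> dist y z * w s"
          using w_pos[OF s] dist_bounded[of y s z] by (simp add: mult.commute)
        finally show "norm (w s *\<^sub>R y s - w s *\<^sub>R z s) \<le> dist y z * w s" .
      qed auto
      moreover have "dist (T y t) (T z t) = norm (V (\<lambda>t. w t *\<^sub>R y t) u - V (\<lambda>t. w t *\<^sub>R z t) u) / w u"
        using w_pos[OF u] unfolding T u_def[symmetric]
        by (simp add: dist_norm divide_inverse_commute flip: scaleR_diff_right)
      ultimately show "dist (T y t) (T z t) \<le> q * dist y z"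
        using w_pos[OF u] by (simp add: pos_divide_le_eq)
    qed
    then obtain y where y: "T y = y" using banach_fix_type[OF q, of T] by blast
    \<comment> \<open>On the box \<open>clamp\<close> is the identity, so multiplying the fixed
      point \<open>y\<close> of \<open>T\<close> by \<open>w\<close> gives a fixed point of
      \<open>V\<close> there.\<close>
    have "V (\<lambda>t. w t *\<^sub>R y t) t = w t *\<^sub>R y t" if "t \<in> cbox a b" for t
      using T[of y t] w0[OF that] clamp_cancel_cbox[OF that] by (simp add: y)
    then show ?thesis using cw by blast
  qed auto
qed

section \<open>Continuity in the upper limit and neighbourhoods in rectangular sets\<close>

text \<open>Stretching turns the integral over the varying box into a parameter integral over the
  fixed unit box. For \<open>t \<ge> 0\<close> and \<open>u\<close> in the unit box,
  \<open>t * u\<close> stays in \<open>[0, t]\<close>, so \<open>g\<close> is evaluated only on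
  \<open>Delta C\<close>.\<close>

lemma continuous_on_integral_cbox_upper:
  fixes g :: "real ^ 'n \<Rightarrow> real ^ 'n \<Rightarrow> 'b::banach"
  assumes g: "continuous_on (Delta C) (\<lambda>(t, s). g t s)" and C: "C \<subseteq> {0..}"
  shows "continuous_on C (\<lambda>t. integral (cbox 0 t) (g t))"
proof -
  have "continuous_on (C \<times> cbox 0 1) (\<lambda>p. (fst p, fst p * snd p))"
    unfolding times_vec_def by (intro continuous_intros)
  moreover have "(\<lambda>p. (fst p, fst p * snd p)) ` (C \<times> cbox 0 1) \<subseteq> Delta C"
    using subsetD[OF C] by (auto simp: Delta_def less_eq_vec_def mem_box_cart intro!: mult_left_le)
  ultimately have "continuous_on (C \<times> cbox 0 1) (\<lambda>p. (\<lambda>(t, s). g t s) (fst p, fst p * snd p))"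
    by (rule continuous_on_compose2[OF g])
  then have "continuous_on (C \<times> cbox 0 1) (\<lambda>(t, u). g t (t * u))"
    by (simp add: split_beta)
  then have "continuous_on C (\<lambda>t. (\<Prod>i\<in>UNIV. t $ i) *\<^sub>R integral (cbox 0 1) (\<lambda>u. g t (t * u)))"
    by (intro continuous_intros integral_continuous_on_param)
  also have "?this \<longleftrightarrow> ?thesis"
  proof (rule continuous_on_cong[OF refl])
    fix t assume t: "t \<in> C"
    have "continuous_on (cbox 0 t) (\<lambda>s. (\<lambda>(t, s). g t s) (t, s))"
      by (rule continuous_on_compose2[OF g])
        (use t in \<open>auto intro!: continuous_intros simp: Delta_def interval_cbox_cart\<close>)
    then show "(\<Prod>i\<in>UNIV. t $ i) *\<^sub>R integral (cbox 0 1) (\<lambda>u. g t (t * u)) = integral (cbox 0 t) (g t)"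
      using t C by (subst integral_cbox_stretch) auto
  qed
  finally show ?thesis .
qed

lemma cbox_subset_rectangular: "rectangular D \<Longrightarrow> t \<in> D \<Longrightarrow> cbox 0 t \<subseteq> D"
  by (auto simp: rectangular_def interval_cbox_cart)

text \<open>This is where closedness of the complement enters: it leaves room to move from
  \<open>t\<close> a little in the diagonal direction without leaving \<open>D\<close>, also when
  \<open>t\<close> lies on a coordinate hyperplane.\<close>

lemma rectangular_neighbourhood:
  assumes D: "rectangular D" and t: "t \<in> D"
  obtains T U where "T \<in> D" "open U" "t \<in> U" "D \<inter> U \<subseteq> cbox 0 T"
proof -
  have "open (- ({0..} - D))" "t \<in> - ({0..} - D)"
    using D t by (auto simp: rectangular_def simp del: Compl_Diff_eq)
  then obtain e where e: "0 < e" "ball t e \<subseteq> - ({0..} - D)"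
    by (meson openE)
  \<comment> \<open>The extra summand 1 in the denominator makes the distance from \<open>t\<close>
    to \<open>T\<close> strictly smaller than \<open>e\<close>.\<close>
  define d where "d = e / (1 + norm (1::real^'a))"
  have pos: "0 < 1 + norm (1::real^'a)" by (simp add: add_pos_nonneg)
  have d: "0 < d" using e pos by (simp add: d_def)
  define T where "T = t + d *\<^sub>R 1"
  have t0: "0 \<le> t" using D t by (auto simp: rectangular_def)
  have "dist t T = d * norm (1::real^'a)" using d by (simp add: T_def dist_norm)
  also have "\<dots> < d * (1 + norm (1::real^'a))" using d by simp
  also have "\<dots> = e" using pos by (simp add: d_def)
  finally have "T \<in> ball t e" by simp
  moreover have "0 \<le> T" using t0 d by (auto simp: T_def less_eq_vec_def intro: add_nonneg_nonneg)
  ultimately have "T \<in> D" using e by auto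
  \<comment> \<open>The lower corner \<open>t - 1\<close> merely has to lie strictly below
    \<open>t\<close>; the bound by 0 in \<open>cbox 0 T\<close> comes from \<open>D\<close>
    itself.\<close>
  moreover have "t \<in> box (t - 1) T" using d by (simp add: mem_box_cart T_def)
  moreover have "D \<inter> box (t - 1) T \<subseteq> cbox 0 T"
    using D by (force simp: rectangular_def mem_box_cart less_eq_vec_def intro: less_imp_le)
  ultimately show ?thesis using that open_box by blast
qed

section \<open>The equation on a single box\<close>

text \<open>The constant \<open>M\<close> serves for all \<open>(t, s)\<close> at once, so one
  weight makes the Volterra operator a contraction on the whole box, without subdividing it.\<close>

lemma volterra_cbox:
  fixes T :: "real ^ 'n" and K :: "real ^ 'n \<Rightarrow> real ^ 'n \<Rightarrow> 'b::banach \<Rightarrow> 'b"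
  assumes K: "continuous_on (Delta (cbox 0 T) \<times> UNIV) (\<lambda>((t, s), x). K t s x)"
    and Lip: "\<And>t s x y. (t, s) \<in> Delta (cbox 0 T) \<Longrightarrow> norm (K t s x - K t s y) \<le> M * norm (x - y)"
    and M: "0 \<le> M"
    and f: "continuous_on (cbox 0 T) f"
  shows volterra_cbox_exists: "\<exists>x. continuous_on (cbox 0 T) x \<and>
      (\<forall>t\<in>cbox 0 T. f t + integral (cbox 0 t) (\<lambda>s. K t s (x s)) = x t)"
    and volterra_cbox_unique: "\<And>x y t. continuous_on (cbox 0 T) x \<Longrightarrow>
      \<forall>t\<in>cbox 0 T. f t + integral (cbox 0 t) (\<lambda>s. K t s (x s)) = x t \<Longrightarrow>
      continuous_on (cbox 0 T) y \<Longrightarrow>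
      \<forall>t\<in>cbox 0 T. f t + integral (cbox 0 t) (\<lambda>s. K t s (y s)) = y t \<Longrightarrow>
      t \<in> cbox 0 T \<Longrightarrow> x t = y t"
proof -
  define V where "V x t = f t + integral (cbox 0 t) (\<lambda>s. K t s (x s))" for x t
  \<comment> \<open>With this choice \<open>c \<ge> 1\<close> and \<open>M < c\<close>. Since the
    dimension is at least 1, \<open>c ^ CARD('n)\<close> is at least \<open>c\<close>, so the factor
    \<open>q\<close> is below 1.\<close>
  define c where "c = M + 1"
  define w where "w t = exp (c * (\<Sum>i\<in>UNIV. t $ i))" for t :: "real ^ 'n"
  define q where "q = M / c ^ CARD('n)"
  have c: "1 \<le> c" "0 < c" "M < c" using M by (auto simp: c_def)
  have "c ^ 1 \<le> c ^ CARD('n)" using c by (intro power_increasing) (auto simp: Suc_le_eq)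
  then have q: "0 \<le> q" "q < 1" using M c by (auto simp: q_def)
  have w: "continuous_on A w" for A unfolding w_def by (intro continuous_intros)
  have Kx: "continuous_on (Delta (cbox 0 T)) (\<lambda>(t, s). K t s (x s))" 
    if x: "continuous_on (cbox 0 T) x" for x
  proof -
    have sub: "snd ` Delta (cbox 0 T) \<subseteq> cbox 0 T"
      by (auto simp: Delta_def simp flip: interval_cbox_cart intro: order_trans)
    have "continuous_on (Delta (cbox 0 T)) (\<lambda>p. (\<lambda>((t, s), x). K t s x) (p, x (snd p)))"
      by (rule continuous_on_compose2[OF K])
        (auto intro!: continuous_intros continuous_on_compose2[OF x _ sub])
    then show ?thesis by (simp add: split_beta)
  qed
  have cont: "continuous_on (cbox 0 T) (V x)" if "continuous_on (cbox 0 T) x" for x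
    unfolding V_def
    by (intro continuous_intros f continuous_on_integral_cbox_upper Kx that)
      (auto simp: mem_box_cart less_eq_vec_def)
  have contraction: "norm (V x t - V y t) \<le> q * C * w t"
    if x: "continuous_on (cbox 0 T) x" and y: "continuous_on (cbox 0 T) y" and C: "0 \<le> C"
      and le: "\<And>s. s \<in> cbox 0 T \<Longrightarrow> norm (x s - y s) \<le> C * w s" and t: "t \<in> cbox 0 T" for x y C t
  proof -
    have D: "(t, s) \<in> Delta (cbox 0 T)" "s \<in> cbox 0 T" if "s \<in> cbox 0 t" for s
      using that t by (auto simp: Delta_def mem_box_cart less_eq_vec_def intro: order_trans)
    have int: "(\<lambda>s. K t s (z s)) integrable_on cbox 0 t" if "continuous_on (cbox 0 T) z" for z
    proof (rule integrable_continuous)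
      have "continuous_on (cbox 0 t) (\<lambda>s. (\<lambda>(t, s). K t s (z s)) (t, s))"
        by (rule continuous_on_compose2[OF Kx[OF that]]) (auto intro!: continuous_intros D)
      then show "continuous_on (cbox 0 t) (\<lambda>s. K t s (z s))" by simp
    qed
    have "norm (V x t - V y t) = norm (integral (cbox 0 t) (\<lambda>s. K t s (x s) - K t s (y s)))"
      using int[OF x] int[OF y] by (simp add: V_def integral_diff)
    also have "\<dots> \<le> integral (cbox 0 t) (\<lambda>s. M * (C * w s))"
    proof (rule integral_norm_bound_integral)
      show "(\<lambda>s. M * (C * w s)) integrable_on cbox 0 t"
        by (intro integrable_continuous continuous_intros w)
      show "norm (K t s (x s) - K t s (y s)) \<le> M * (C * w s)" if s: "s \<in> cbox 0 t" for s
        using Lip[OF D(1)[OF s], of "x s" "y s"] mult_left_mono[OF le[OF D(2)[OF s]] M] by simp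
    qed (intro integrable_diff int x y)
    also have "\<dots> = M * C * integral (cbox 0 t) w" by (simp add: mult.assoc)
    also have "\<dots> \<le> M * C * (w t / c ^ CARD('n))"
      using t M C c unfolding w_def
      by (intro mult_left_mono integral_exp_sum_le) (auto simp: mem_box_cart less_eq_vec_def)
    finally show ?thesis by (simp add: q_def)
  qed
  have w_pos: "0 < w t" for t by (simp add: w_def)
  note fixpoint = weighted_contraction_fixpoint[of 0 T V w q, OF cont w w_pos q contraction]
    and unique = weighted_contraction_fixpoint_unique[of 0 T V w q, OF cont w w_pos q contraction]
  show "\<exists>x. continuous_on (cbox 0 T) x \<and>
      (\<forall>t\<in>cbox 0 T. f t + integral (cbox 0 t) (\<lambda>s. K t s (x s)) = x t)"
    using fixpoint unfolding V_def by blast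
  show "x t = y t" if "continuous_on (cbox 0 T) x"
      "\<forall>t\<in>cbox 0 T. f t + integral (cbox 0 t) (\<lambda>s. K t s (x s)) = x t"
      "continuous_on (cbox 0 T) y"
      "\<forall>t\<in>cbox 0 T. f t + integral (cbox 0 t) (\<lambda>s. K t s (y s)) = y t"
      "t \<in> cbox 0 T" for x y t
    by (rule unique[of x y t]) (use that in \<open>auto simp: V_def\<close>)
qed

section \<open>Gluing the solutions on boxes\<close>

theorem theorem5:
  fixes D :: "(real ^ 'n) set"
    and K :: "real ^ 'n \<Rightarrow> real ^ 'n \<Rightarrow> 'b::banach \<Rightarrow> 'b"
    and L :: "real ^ 'n \<Rightarrow> real"
    and f :: "real ^ 'n \<Rightarrow> 'b"
  assumes "rectangular D"
    and "continuous_on (Delta D \<times> UNIV) (\<lambda>((t, s), x). K t s x)"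
    and "continuous_on D L" and "\<And>t. t \<in> D \<Longrightarrow> 0 < L t"
    and "\<And>t s x y. (t, s) \<in> Delta D \<Longrightarrow> norm (K t s x - K t s y) \<le> L t * norm (x - y)"
    and "continuous_on D f"
  shows "\<exists>!x. x \<in> continuous_maps D \<and>
           (\<forall>t\<in>D. x t = f t + strong_bochner_integral (lebesgue_on {0..t}) (\<lambda>s. K t s (x s)))"
proof -
  note D = assms(1) and K = assms(2) and Lip = assms(5)
  note sub = cbox_subset_rectangular[OF D]
  have self: "t \<in> cbox 0 t" if "t \<in> D" for t
    using D that by (auto simp: rectangular_def interval_cbox_cart[symmetric])
  define sol where "sol T x \<longleftrightarrow> continuous_on (cbox 0 T) x \<and>
    (\<forall>t\<in>cbox 0 T. f t + integral (cbox 0 t) (\<lambda>s. K t s (x s)) = x t)" for T x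
  \<comment> \<open>Agreement at the corner \<open>T\<close> suffices, because every point of
    \<open>D\<close> is the corner of its own box.\<close>
  have box: "(\<exists>x. sol T x) \<and> (\<forall>x y. sol T x \<longrightarrow> sol T y \<longrightarrow> x T = y T)" if T: "T \<in> D" for T
  proof -
    have "compact (L ` cbox 0 T)"
      by (intro compact_continuous_image continuous_on_subset[OF assms(3) sub[OF T]] compact_cbox)
    then have "bdd_above (L ` cbox 0 T)"
      by (intro bounded_imp_bdd_above compact_imp_bounded)
    then obtain M where M: "\<And>t. t \<in> cbox 0 T \<Longrightarrow> L t \<le> M"
      unfolding bdd_above_def by blast
    have M0: "0 \<le> M" using M[OF self[OF T]] assms(4)[OF T] by simp
    have DT: "Delta (cbox 0 T) \<subseteq> Delta D" using sub[OF T] by (auto simp: Delta_def)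
    have K': "continuous_on (Delta (cbox 0 T) \<times> UNIV) (\<lambda>((t, s), x). K t s x)"
      by (rule continuous_on_subset[OF K]) (use DT in auto)
    have Lip': "norm (K t s x - K t s y) \<le> M * norm (x - y)" if "(t, s) \<in> Delta (cbox 0 T)" for t s x y
    proof -
      have "t \<in> cbox 0 T" using that by (simp add: Delta_def)
      then have "L t * norm (x - y) \<le> M * norm (x - y)" by (intro mult_right_mono M) auto
      then show ?thesis using Lip[of t s x y] that DT by force
    qed
    have f': "continuous_on (cbox 0 T) f" by (rule continuous_on_subset[OF assms(6) sub[OF T]])
    show ?thesis
      using volterra_cbox_exists[OF K' Lip' M0 f'] volterra_cbox_unique[OF K' Lip' M0 f'] self[OF T]
      unfolding sol_def by blast
  qed
  have sol_mono: "sol s x" if "sol T x" "s \<in> cbox 0 T" for s T x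
  proof -
    have "cbox 0 s \<subseteq> cbox 0 T"
      using that(2) by (auto simp flip: interval_cbox_cart intro: order_trans)
    then show ?thesis using that(1) unfolding sol_def by (blast intro: continuous_on_subset)
  qed
  obtain X where X: "\<And>T. T \<in> D \<Longrightarrow> sol T (X T)" using box by metis
  \<comment> \<open>The value at \<open>t\<close> comes from the solution on \<open>[0, t]\<close>,
    at its corner. It agrees with \<open>X T\<close> on all of \<open>[0, T]\<close>: for
    \<open>s\<close> in that box, \<open>X s\<close> and \<open>X T\<close> both solve the equation
    on \<open>[0, s]\<close>, hence agree at \<open>s\<close>.\<close>
  define x where "x = restrict (\<lambda>t. X t t) D"
  have x_eq: "x s = X T s" if T: "T \<in> D" and s: "s \<in> cbox 0 T" for s T
  proof -
    have "s \<in> D" using sub[OF T] s by blast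
    then show ?thesis using box[of s] X[of s] sol_mono[OF X[OF T] s] by (simp add: x_def)
  qed
  \<comment> \<open>For continuous \<open>y\<close> the integrands are continuous, so the global
    equation with the strong Bochner integral is the same as the family of equations on boxes.
    Existence and uniqueness both pass through this equivalence.\<close>
  have sol_D: "(\<forall>t\<in>D. y t = f t + strong_bochner_integral (lebesgue_on {0..t}) (\<lambda>s. K t s (y s)))
      \<longleftrightarrow> (\<forall>T\<in>D. sol T y)" if y: "continuous_on D y" for y
  proof -
    let ?F = "\<lambda>t. f t + strong_bochner_integral (lebesgue_on {0..t}) (\<lambda>s. K t s (y s))"
    have int: "strong_bochner_integral (lebesgue_on {0..t}) (\<lambda>s. K t s (y s)) =
        integral (cbox 0 t) (\<lambda>s. K t s (y s))" if t: "t \<in> D" for t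
      unfolding interval_cbox_cart
    proof (rule strong_bochner_integral_continuous)
      have "continuous_on (cbox 0 t) (\<lambda>s. (\<lambda>((t, s), x). K t s x) ((t, s), y s))"
        by (rule continuous_on_compose2[OF K])
          (use t in \<open>auto intro!: continuous_intros continuous_on_subset[OF y sub[OF t]]
            simp: Delta_def interval_cbox_cart\<close>)
      then show "continuous_on (cbox 0 t) (\<lambda>s. K t s (y s))" by simp
    qed
    have "sol T y \<longleftrightarrow> (\<forall>t\<in>cbox 0 T. y t = ?F t)" if T: "T \<in> D" for T
    proof -
      have "f t + integral (cbox 0 t) (\<lambda>s. K t s (y s)) = y t \<longleftrightarrow> y t = ?F t" if "t \<in> cbox 0 T" for t
        using int[of t] sub[OF T] that by auto
      then show ?thesis
        using continuous_on_subset[OF y sub[OF T]] by (simp add: sol_def)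
    qed
    then show ?thesis using sub self by blast
  qed
  have sol_x: "sol T x" if T: "T \<in> D" for T
  proof -
    have "continuous_on (cbox 0 T) x"
      using X[OF T] continuous_on_cong[of "cbox 0 T" "cbox 0 T" x "X T", OF refl x_eq[OF T]]
      by (simp add: sol_def)
    moreover have "integral (cbox 0 t) (\<lambda>s. K t s (x s)) = integral (cbox 0 t) (\<lambda>s. K t s (X T s))"
      if "t \<in> cbox 0 T" for t
    proof (rule integral_cong)
      fix s assume "s \<in> cbox 0 t"
      then have "s \<in> cbox 0 T"
        using that by (auto simp flip: interval_cbox_cart intro: order_trans)
      then show "K t s (x s) = K t s (X T s)" by (simp add: x_eq[OF T])
    qed
    ultimately show ?thesis using X[OF T] x_eq[OF T] unfolding sol_def by simp
  qed
  have cont: "continuous_on D x"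
    unfolding continuous_on_eq_continuous_within
  proof
    fix t assume t: "t \<in> D"
    obtain T U where TU: "T \<in> D" "open U" "t \<in> U" "D \<inter> U \<subseteq> cbox 0 T"
      using rectangular_neighbourhood[OF D t] .
    \<comment> \<open>Inside \<open>U\<close> the sets \<open>D\<close> and \<open>cbox 0 T\<close>
      coincide, so continuity at \<open>t\<close> transfers from the box to
      \<open>D\<close>.\<close>
    have "at t within D = at t within cbox 0 T"
      by (rule at_within_nhd[OF TU(3,2)]) (use TU(4) sub[OF TU(1)] in auto)
    moreover have "continuous (at t within cbox 0 T) x"
      using sol_x[OF TU(1)] t TU(3,4) by (auto simp: sol_def continuous_on_eq_continuous_within)
    ultimately show "continuous (at t within D) x" by simp
  qed
  have ext: "x \<in> extensional D" by (simp add: x_def)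
  show ?thesis
  proof (rule ex1I[of _ x])
    show "x \<in> continuous_maps D \<and>
        (\<forall>t\<in>D. x t = f t + strong_bochner_integral (lebesgue_on {0..t}) (\<lambda>s. K t s (x s)))"
      using cont ext sol_x by (simp add: continuous_maps_def sol_D[OF cont])
  next
    fix y
    assume "y \<in> continuous_maps D \<and>
        (\<forall>t\<in>D. y t = f t + strong_bochner_integral (lebesgue_on {0..t}) (\<lambda>s. K t s (y s)))"
    then have y: "y \<in> extensional D" "\<And>T. T \<in> D \<Longrightarrow> sol T y"
      using sol_D[of y] by (auto simp: continuous_maps_def)
    show "y = x"
    proof (rule extensionalityI[OF y(1) ext])
      fix t assume t: "t \<in> D"
      then show "y t = x t" using box[OF t] y(2)[OF t] sol_x[OF t] by simp
    qed
  qed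
qed

end
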